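(* Let $\gamma>1$ and let $(q_i)_{i\ge1}$ be a probability distribution on $\mathbb N=\{1,2,\dots\}$ with $q_i\asymp i^{-\gamma}$. Let $(G_m)_{m\ge1}$ be the rank 1 simple random graphs constructed from $(q_i)$. Then the $G_m$ have a power-law degree distribution with exponent $2$ in the following sense: there exist positive constants $c$ and $C$ such that almost surely, for every sufficiently large $m$, $$\pi_{\ge k}(G_m)\le \frac{C}{k}\qquad\text{for all integers } 1\le k<\infty,$$ $$\pi_{\ge k}(G_m)\ge \frac{c}{k}\qquad\text{for all integers } 1\le k\le c\,v(G_m).$$
   Context: $f\asymp g$ for non-negative sequences means that there are constants $c_0,C_0>0$ with $c_0 g(i)\le f(i)\le C_0 g(i)$ for all $i$. Rank 1 simple random graphs: put $\mu_{ij}:=2q_iq_j$ for $i\ne j$, $\mu_{ii}:=0$, and $\|\mu\|:=\sum_{i<j}\mu_{ij}$. Let $Y_1,Y_2,\dots$ be i.i.d. random two-element subsets of $\mathbb N$ with $\mathbb P(Y_k=\{i,j\})=\mu_{ij}/\|\mu\|$ for $i<j$. Then $G_m$ is the simple graph with edge set $\{Y_k:1\le k\le m\}$ (repeated edges merged) and vertex set $\bigcup_{k\le m}Y_k$. All $G_m$ are built from the same sequence $(Y_k)$. For a finite graph $G$, $v(G)$ is its number of vertices, $v_{\ge k}(G)$ is the number of vertices of degree at least $k$, and $\pi_{\ge k}(G):=v_{\ge k}(G)/v(G)$. The constants $c,C$ are deterministic (they may depend on $(q_i)$) and do not depend on $m$ or $k$; the threshold for "sufficiently large $m$" may be random. 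*)

theory Defs
  imports "HOL-Probability.Probability"
begin

text \<open>The index set \<open>{1, 2, ...}\<close> is \<open>{1..} :: nat set\<close>; values at index 0 are never used.\<close>

definition asymp_seq :: "(nat \<Rightarrow> real) \<Rightarrow> (nat \<Rightarrow> real) \<Rightarrow> bool" where
  "asymp_seq f g \<longleftrightarrow> (\<exists>c\<^sub>0>0. \<exists>C\<^sub>0>0. \<forall>i\<ge>1. c\<^sub>0 * g i \<le> f i \<and> f i \<le> C\<^sub>0 * g i)"

text \<open>A graph is a pair of a vertex set and a set of edges, each edge being the set of
  its two endpoints.\<close>

type_synonym 'v graph = "'v set \<times> 'v set set"

definition vertex_degree :: "'v graph \<Rightarrow> 'v \<Rightarrow> nat" where
  "vertex_degree G x = card {e \<in> snd G. x \<in> e}"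

definition num_vertices :: "'v graph \<Rightarrow> nat" where
  "num_vertices G = card (fst G)"

definition num_vertices_ge :: "nat \<Rightarrow> 'v graph \<Rightarrow> nat" where
  "num_vertices_ge k G = card {x \<in> fst G. k \<le> vertex_degree G x}"

definition prop_ge :: "nat \<Rightarrow> 'v graph \<Rightarrow> real" where
  "prop_ge k G = real (num_vertices_ge k G) / real (num_vertices G)"

definition mu :: "nat pmf \<Rightarrow> nat \<Rightarrow> nat \<Rightarrow> real" where
  "mu q i j = (if i = j then 0 else 2 * pmf q i * pmf q j)"

definition mu_norm :: "nat pmf \<Rightarrow> real" where
  "mu_norm q = (\<Sum>\<^sub>\<infinity>(i, j)\<in>{(i, j). 1 \<le> i \<and> i < j}. mu q i j)"

definition two_subsets :: "nat set set" where
  "two_subsets = {e. e \<subseteq> {1..} \<and> card e = 2}"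

text \<open>Since \<open>two_subsets\<close> is countable, \<open>count_space two_subsets\<close> is its natural measurable
  structure.  Measurability into it makes every \<open>Y k\<close> with \<open>k \<ge> 1\<close> take values in
  \<open>two_subsets\<close>.\<close>

definition rank1_edge_sequence ::
    "nat pmf \<Rightarrow> 'a measure \<Rightarrow> (nat \<Rightarrow> 'a \<Rightarrow> nat set) \<Rightarrow> bool" where
  "rank1_edge_sequence q M Y \<longleftrightarrow>
     prob_space M \<and>
     prob_space.indep_vars M (\<lambda>_. count_space two_subsets) Y {1..} \<and>
     (\<forall>k\<ge>1. \<forall>i j. 1 \<le> i \<longrightarrow> i < j \<longrightarrow>
        measure M {\<omega> \<in> space M. Y k \<omega> = {i, j}} = mu q i j / mu_norm q)"

definition rank1_graph :: "(nat \<Rightarrow> 'a \<Rightarrow> nat set) \<Rightarrow> nat \<Rightarrow> 'a \<Rightarrow> nat graph" where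
  "rank1_graph Y m \<omega> = (\<Union>k\<in>{1..m}. Y k \<omega>, (\<lambda>k. Y k \<omega>) ` {1..m})"

end

theory Submission
  imports Defs "HOL-Real_Asymp.Real_Asymp"
begin

text \<open>
  Put \<open>N = m powr (1 / \<gamma>)\<close>.  The expected number of occurrences of a given pair \<open>{i, j}\<close> among
  the first \<open>m\<close> draws is of order \<open>(N / (i * j)) powr \<gamma>\<close>.  Hence pairs with \<open>i * j\<close> well below \<open>N\<close> are almost all present,
  and pairs with \<open>i * j\<close> above \<open>N\<close> are rare: vertex \<open>i\<close> has degree of order \<open>N / i\<close>, and there are of
  order \<open>N / k\<close> vertices of degree at least \<open>k\<close>.  With \<open>k = 1\<close> this also gives the number of vertices,
  and the quotient is of order \<open>1 / k\<close>.  It remains to make this precise simultaneously for all \<open>k\<close>,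
  including those \<open>k\<close> of order \<open>N\<close> for which the count is bounded.

  Upper bound.  The first \<open>2 * N / k\<close> vertices can be ignored.  Any other vertex \<open>i\<close> of degree at least
  \<open>k\<close> has at least \<open>k / 2\<close> neighbours \<open>j > k / 2\<close>.  Such an edge has \<open>i > 2 * N / k\<close> and \<open>j > k / 2\<close>,
  and the expected number of draws of this kind is \<open>O(N)\<close> uniformly in \<open>k\<close>, because the sum
  of \<open>m * (i * j) powr (- \<gamma>)\<close> factorises (\<open>prob_far_le\<close>).  As a sum of independent indicators, the
  number of draws is \<open>O(N)\<close> outside an event of probability \<open>exp (- N)\<close> (\<open>prob_crowded\<close>), and then
  there are \<open>O(N / k)\<close> such vertices (\<open>num_vertices_ge_upper\<close>).

  Lower bound.  Consider the rectangle of pairs \<open>i \<le> I = a * N / k\<close> and \<open>j \<le> 2 * k\<close>.  If fewer than half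
  of the vertices \<open>i \<le> I\<close> have degree at least \<open>k\<close>, then at least an eighth of the \<open>2 * I * k\<close> pairs is
  missing (\<open>many_missing_edges\<close>).  For small \<open>a\<close> the probability that a prescribed set of that
  size is missing is so small that summing it over all sets still leaves \<open>exp (- (a / 2 * N))\<close>
  (\<open>prob_hollow\<close>).

  Both failure probabilities, multiplied by the at most \<open>m\<close> relevant values of \<open>k\<close>, are summable in
  \<open>m\<close>, and the Borel-Cantelli lemma finishes the proof.
\<close>

section \<open>Analytic estimates\<close>

text \<open>The failure probabilities below have this form with \<open>d = 1 / \<gamma>\<close>; the factor \<open>m\<close> comes from a
union bound over the degrees \<open>k \<le> m\<close>.\<close>

lemma summable_stretched_exponential:
  fixes c d :: real
  assumes "c > 0" "d > 0"
  shows "summable (\<lambda>m::nat. real m * exp (- c * real m powr d))"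
proof (rule summable_comparison_test_bigo)
  show "summable (\<lambda>m::nat. norm (real m powr (-2)))"
    by (simp add: summable_real_powr_iff)
  show "(\<lambda>m::nat. real m * exp (- c * real m powr d)) \<in> O(\<lambda>m. real m powr (-2))"
    using assms by real_asymp
qed

text \<open>By the mean value theorem, \<open>x powr (- \<gamma>)\<close> is at most a constant times
\<open>x powr (1 - \<gamma>) - (x + 1) powr (1 - \<gamma>)\<close>, so that the series is dominated by a telescoping one.
The factor \<open>2 powr \<gamma>\<close> pays for \<open>z < x + 1 \<le> 2 * x\<close> at the intermediate point \<open>z\<close>.\<close>

lemma powr_tail_sum:
  fixes \<gamma> :: real and n :: nat
  assumes "\<gamma> > 1" and "n \<ge> 1"
  shows "summable (\<lambda>j. real (n + j) powr (- \<gamma>))"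
    and "(\<Sum>j. real (n + j) powr (- \<gamma>)) \<le> 2 powr \<gamma> / (\<gamma> - 1) * real n powr (1 - \<gamma>)"
proof -
  define Z where "Z = 2 powr \<gamma> / (\<gamma> - 1)"
  define g where "g j = Z * real (n + j) powr (1 - \<gamma>)" for j
  have Z: "Z > 0" using assms by (simp add: Z_def)
  have "(\<lambda>j. g j - g (Suc j)) sums (g 0 - 0)"
  proof (rule telescope_sums')
    show "g \<longlonglongrightarrow> 0" unfolding g_def using assms by real_asymp
  qed
  moreover have step: "real (n + j) powr (- \<gamma>) \<le> g j - g (Suc j)" for j
  proof -
    define x where "x = real (n + j)"
    have x: "x \<ge> 1" using assms by (simp add: x_def)
    have "\<exists>z. x < z \<and> z < x + 1 \<and>
        (x + 1) powr (1 - \<gamma>) - x powr (1 - \<gamma>) = (x + 1 - x) * ((1 - \<gamma>) * z powr (- \<gamma>))"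
    proof (rule MVT2)
      fix z assume "x \<le> z" "z \<le> x + 1"
      then show "((\<lambda>z. z powr (1 - \<gamma>)) has_real_derivative (1 - \<gamma>) * z powr (- \<gamma>)) (at z)"
        using x by (auto intro!: derivative_eq_intros)
    qed simp
    then obtain z where z: "x < z" "z < x + 1"
      "x powr (1 - \<gamma>) - (x + 1) powr (1 - \<gamma>) = (\<gamma> - 1) * z powr (- \<gamma>)"
      by (auto simp: algebra_simps)
    have "(2 * x) powr (- \<gamma>) \<le> z powr (- \<gamma>)"
      by (rule powr_mono2') (use assms x z in auto)
    then have "x powr (- \<gamma>) \<le> 2 powr \<gamma> * z powr (- \<gamma>)"
      using x by (simp add: powr_mult powr_minus field_simps)
    also have "\<dots> = Z * (x powr (1 - \<gamma>) - (x + 1) powr (1 - \<gamma>))"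
      using assms by (simp add: z Z_def)
    finally show ?thesis
      by (simp add: x_def g_def algebra_simps)
  qed
  ultimately have sm: "summable (\<lambda>j. g j - g (Suc j))" and s: "(\<Sum>j. g j - g (Suc j)) = g 0"
    by (auto simp: sums_iff)
  show 1: "summable (\<lambda>j. real (n + j) powr (- \<gamma>))"
    by (rule summable_comparison_test'[OF sm, of 0]) (use step in auto)
  show "(\<Sum>j. real (n + j) powr (- \<gamma>)) \<le> 2 powr \<gamma> / (\<gamma> - 1) * real n powr (1 - \<gamma>)"
    using suminf_le[OF step 1 sm] s by (simp add: g_def Z_def)
qed

section \<open>Counting degrees in a finite graph\<close>

definition far_edges :: "nat \<Rightarrow> nat \<Rightarrow> nat set set" where
  "far_edges L K = {{i, j} |i j. L < i \<and> K < j \<and> i \<noteq> j}"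

definition near_edges :: "nat \<Rightarrow> nat \<Rightarrow> nat set set" where
  "near_edges I J = (\<lambda>(i, j). {i, j}) ` {(i, j) \<in> {1..I} \<times> {1..J}. i \<noteq> j}"

lemma far_edgesI: "L < i \<Longrightarrow> K < j \<Longrightarrow> i \<noteq> j \<Longrightarrow> {i, j} \<in> far_edges L K"
  unfolding far_edges_def by blast

lemma far_edges_two_subsets: "far_edges L K \<subseteq> two_subsets"
  by (auto simp: far_edges_def two_subsets_def)

lemma near_edges_two_subsets: "near_edges I J \<subseteq> two_subsets"
  by (auto simp: near_edges_def two_subsets_def)

lemma two_subsets_finite: "e \<in> two_subsets \<Longrightarrow> finite e"
  by (rule card_ge_0_finite) (simp add: two_subsets_def)

lemma finite_near_edges: "finite (near_edges I J)"
  and card_near_edges: "card (near_edges I J) \<le> I * J"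
proof -
  have fin: "finite {(i, j) \<in> {1..I} \<times> {1..J}. i \<noteq> j}"
    by (rule finite_subset[of _ "{1..I} \<times> {1..J}"]) auto
  then show "finite (near_edges I J)" unfolding near_edges_def by (rule finite_imageI)
  have "card (near_edges I J) \<le> card {(i, j) \<in> {1..I} \<times> {1..J}. i \<noteq> j}"
    unfolding near_edges_def by (rule card_image_le[OF fin])
  also have "\<dots> \<le> card ({1..I} \<times> {1..J})" by (intro card_mono) auto
  finally show "card (near_edges I J) \<le> I * J" by simp
qed

text \<open>Double counting of incidences: an edge has only two endpoints.\<close>

lemma sum_incident_le:
  fixes D :: "nat set"
  assumes "finite D" "finite S" "S \<subseteq> two_subsets"
    and "\<And>i. i \<in> D \<Longrightarrow> r \<le> card {e \<in> S. i \<in> e}"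
  shows "card D * r \<le> 2 * card S"
proof -
  have "card D * r \<le> (\<Sum>i\<in>D. card {e \<in> S. i \<in> e})"
    using sum_bounded_below[of D r "\<lambda>i. card {e \<in> S. i \<in> e}"] assms(4) by simp
  also have "\<dots> = (\<Sum>e\<in>S. card {i \<in> D. i \<in> e})"
    by (rule sum_multicount_gen) (use assms in auto)
  also have "\<dots> \<le> (\<Sum>e\<in>S. card e)"
  proof (rule sum_mono)
    fix e assume "e \<in> S"
    then have "finite e" using assms(3) two_subsets_finite by blast
    then show "card {i \<in> D. i \<in> e} \<le> card e" by (intro card_mono) auto
  qed
  also have "\<dots> = (\<Sum>e\<in>S. 2)"
    by (rule sum.cong) (use assms(3) in \<open>auto simp: two_subsets_def\<close>)
  finally show ?thesis by simp
qed

lemma two_subset_with: 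
  assumes "e \<in> two_subsets" "i \<in> e" 
  obtains j where "e = {i, j}" "j \<noteq> i" "j \<ge> 1"
proof -
  from assms(1) have "card e = 2" "e \<subseteq> {1..}" by (auto simp: two_subsets_def)
  then obtain a b where "e = {a, b}" "a \<noteq> b" by (auto simp: card_2_iff)
  then show ?thesis using assms(2) \<open>e \<subseteq> {1..}\<close> that[of a] that[of b] by auto
qed

text \<open>Vertices up to \<open>L\<close> contribute at most \<open>L\<close>.  A vertex \<open>i > L\<close> has at most \<open>k div 2\<close> neighbours in
\<open>{1..k div 2}\<close>, so if its degree is at least \<open>k\<close>, then at least half of those \<open>k\<close> neighbours
lie beyond and give far edges.  Discarding the small neighbours for free is what makes a first
moment bound on the far edges sufficient.\<close>

lemma num_vertices_ge_upper:
  assumes F: "finite F" "F \<subseteq> two_subsets" and k: "k \<ge> 1"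
  shows "num_vertices_ge k (\<Union>F, F) * k \<le> L * k + 4 * card {e \<in> F. e \<in> far_edges L (k div 2)}"
proof -
  define K where "K = k div 2"
  define S where "S = {e \<in> F. e \<in> far_edges L K}"
  define V where "V = {x \<in> \<Union>F. k \<le> vertex_degree (\<Union>F, F) x}"
  define D where "D = {x \<in> V. L < x}"
  have finU: "finite (\<Union>F)"
    by (intro finite_Union F) (use F two_subsets_finite in blast)
  have pos: "x \<ge> 1" if "x \<in> V" for x
  proof -
    obtain e where "e \<in> F" "x \<in> e" using \<open>x \<in> V\<close> unfolding V_def by blast
    then show ?thesis using F unfolding two_subsets_def by auto
  qed
  have "card D * (k - K) \<le> 2 * card S"
  proof (rule sum_incident_le)
    show "finite D" using finU by (rule rev_finite_subset) (auto simp: D_def V_def)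
    show "finite S" "S \<subseteq> two_subsets" using F by (auto simp: S_def)
    fix i assume i: "i \<in> D"
    have "{e \<in> F. i \<in> e} \<subseteq> {e \<in> S. i \<in> e} \<union> (\<lambda>j. {i, j}) ` {1..K}"
    proof
      fix e assume e: "e \<in> {e \<in> F. i \<in> e}"
      then obtain j where "e = {i, j}" "j \<noteq> i" "j \<ge> 1"
        using two_subset_with[of e i] F by auto
      then show "e \<in> {e \<in> S. i \<in> e} \<union> (\<lambda>j. {i, j}) ` {1..K}"
        using e i far_edgesI[of L i K j] by (cases "j \<le> K") (auto simp: S_def D_def)
    qed
    then have "card {e \<in> F. i \<in> e} \<le> card ({e \<in> S. i \<in> e} \<union> (\<lambda>j. {i, j}) ` {1..K})"
      by (intro card_mono) (use F in \<open>auto simp: S_def\<close>)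
    also have "\<dots> \<le> card {e \<in> S. i \<in> e} + card ((\<lambda>j. {i, j}) ` {1..K})"
      by (rule card_Un_le)
    also have "\<dots> \<le> card {e \<in> S. i \<in> e} + K"
      using card_image_le[of "{1..K}" "\<lambda>j. {i, j}"] by simp
    finally have "card {e \<in> F. i \<in> e} \<le> card {e \<in> S. i \<in> e} + K" .
    moreover have "k \<le> card {e \<in> F. i \<in> e}"
      using i by (simp add: D_def V_def vertex_degree_def)
    ultimately show "k - K \<le> card {e \<in> S. i \<in> e}" by linarith
  qed
  moreover have "card D * k \<le> card D * (2 * (k - K))"
    by (rule mult_le_mono2) (simp add: K_def)
  ultimately have D: "card D * k \<le> 4 * card S" by linarith
  have "card V \<le> card ({1..L} \<union> D)"
  proof (rule card_mono)
    have "finite V" using finU by (rule rev_finite_subset) (auto simp: V_def)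
    then show "finite ({1..L} \<union> D)" by (simp add: D_def)
    show "V \<subseteq> {1..L} \<union> D" using pos by (auto simp: D_def)
  qed
  also have "\<dots> \<le> L + card D" using card_Un_le[of "{1..L}" D] by simp
  finally have "card V * k \<le> (L + card D) * k" by (rule mult_le_mono1)
  then have "card V * k \<le> L * k + 4 * card S" using D by (simp add: algebra_simps)
  then show ?thesis
    by (simp add: num_vertices_ge_def V_def S_def K_def)
qed

text \<open>If fewer than half of the vertices in \<open>{1..I}\<close> have degree at least \<open>k\<close>, then each of the others has
fewer than \<open>k\<close> of its \<open>2 * k - 1\<close> or more potential neighbours in \<open>{1..2 * k}\<close>, so a fixed
proportion of the near edges is absent.\<close>

lemma many_missing_edges:
  assumes F: "finite F" "F \<subseteq> two_subsets" and k: "k \<ge> 1"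
    and few: "2 * num_vertices_ge k (\<Union>F, F) < I"
  shows "I * k \<le> 4 * card (near_edges I (2 * k) - F)"
proof -
  define S where "S = near_edges I (2 * k) - F"
  define V where "V = {x \<in> \<Union>F. k \<le> vertex_degree (\<Union>F, F) x}"
  define D where "D = {1..I} - V"
  have finU: "finite (\<Union>F)"
    by (intro finite_Union F) (use F two_subsets_finite in blast)
  have "card D * k \<le> 2 * card S"
  proof (rule sum_incident_le)
    show "finite D" by (simp add: D_def)
    show finS: "finite S" by (simp add: S_def finite_near_edges)
    show "S \<subseteq> two_subsets" using near_edges_two_subsets by (auto simp: S_def)
    fix i assume i: "i \<in> D"
    have deg: "card {e \<in> F. i \<in> e} < k"
    proof (rule ccontr)
      assume *: "\<not> card {e \<in> F. i \<in> e} < k"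
      then have "{e \<in> F. i \<in> e} \<noteq> {}" using k by (intro notI) simp
      then show False using i * by (auto simp: D_def V_def vertex_degree_def)
    qed
    have "2 * k - 1 \<le> card ({1..2 * k} - {i})"
      using card_Diff1_le diff_card_le_card_Diff[of "{i}" "{1..2 * k}"] by simp
    also have "\<dots> = card ((\<lambda>j. {i, j}) ` ({1..2 * k} - {i}))"
      by (rule card_image[symmetric]) (auto simp: inj_on_def doubleton_eq_iff)
    also have "\<dots> \<le> card ({e \<in> S. i \<in> e} \<union> {e \<in> F. i \<in> e})"
    proof (rule card_mono)
      show "finite ({e \<in> S. i \<in> e} \<union> {e \<in> F. i \<in> e})" using finS F by auto
      have "{i, j} \<in> near_edges I (2 * k)" if "j \<in> {1..2 * k} - {i}" for j
        unfolding near_edges_def using that i by (intro image_eqI[of _ _ "(i, j)"]) (auto simp: D_def)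
      then show "(\<lambda>j. {i, j}) ` ({1..2 * k} - {i}) \<subseteq> {e \<in> S. i \<in> e} \<union> {e \<in> F. i \<in> e}"
        unfolding S_def by blast
    qed
    also have "\<dots> \<le> card {e \<in> S. i \<in> e} + card {e \<in> F. i \<in> e}" by (rule card_Un_le)
    finally show "k \<le> card {e \<in> S. i \<in> e}" using deg by linarith
  qed
  then have *: "2 * (card D * k) \<le> 4 * card S" by linarith
  have "I \<le> 2 * card D"
  proof -
    have "finite V" using finU by (rule rev_finite_subset) (auto simp: V_def)
    then have "I - card V \<le> card D"
      using diff_card_le_card_Diff[of V "{1..I}"] by (simp add: D_def)
    then show ?thesis using few by (simp add: num_vertices_ge_def V_def)
  qed
  then have "I * k \<le> 2 * card D * k" by (rule mult_le_mono1)
  then have "I * k \<le> 2 * (card D * k)" by (simp only: mult.assoc)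
  with * show ?thesis unfolding S_def by linarith
qed

section \<open>Hitting and avoiding sets of edges\<close>

locale indep_edges = prob_space M for M :: "'a measure" +
  fixes Y :: "nat \<Rightarrow> 'a \<Rightarrow> nat set"
  assumes indep: "indep_vars (\<lambda>_. count_space two_subsets) Y {1..}"
begin

lemma Y_measurable: "t \<ge> 1 \<Longrightarrow> Y t \<in> measurable M (count_space two_subsets)"
  using indep by (auto simp: indep_vars_def)

lemma Y_two_subsets: "t \<ge> 1 \<Longrightarrow> \<omega> \<in> space M \<Longrightarrow> Y t \<omega> \<in> two_subsets"
  using measurable_space[OF Y_measurable] by fastforce

lemma Y_event: "t \<ge> 1 \<Longrightarrow> {\<omega> \<in> space M. Y t \<omega> \<in> E} \<in> events"
proof -
  assume t: "t \<ge> 1"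
  have "Y t -` (E \<inter> two_subsets) \<inter> space M \<in> events"
    by (rule measurable_sets[OF Y_measurable[OF t]]) simp
  also have "Y t -` (E \<inter> two_subsets) \<inter> space M = {\<omega> \<in> space M. Y t \<omega> \<in> E}"
    using Y_two_subsets[OF t] by auto
  finally show ?thesis .
qed

lemma avoid_event: "{\<omega> \<in> space M. \<forall>t\<in>{1..m}. Y t \<omega> \<notin> E} \<in> events"
proof -
  have "{\<omega> \<in> space M. \<forall>t\<in>{1..m}. Y t \<omega> \<in> - E} \<in> events"
    by (intro sets.sets_Collect_finite_All Y_event) auto
  then show ?thesis by simp
qed

text \<open>A single draw avoids \<open>E\<close> with probability at most \<open>1 - card E * p \<le> exp (- (card E * p))\<close>.\<close>

lemma prob_avoid_le:
  assumes m: "m \<ge> 1" and E: "finite E"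
    and p: "\<And>t e. t \<ge> 1 \<Longrightarrow> e \<in> E \<Longrightarrow> prob {\<omega> \<in> space M. Y t \<omega> = e} \<ge> p"
  shows "prob {\<omega> \<in> space M. \<forall>t\<in>{1..m}. Y t \<omega> \<notin> E} \<le> exp (- (real m * real (card E) * p))"
proof -
  have one: "prob (Y t -` (two_subsets - E) \<inter> space M) \<le> exp (- (real (card E) * p))" if t: "t \<ge> 1" for t
  proof -
    have ev: "{\<omega> \<in> space M. Y t \<omega> = e} \<in> events" for e using Y_event[OF t, of "{e}"] by simp
    have "real (card E) * p \<le> (\<Sum>e\<in>E. prob {\<omega> \<in> space M. Y t \<omega> = e})"
      using sum_bounded_below[of E p] p[OF t] by simp
    also have "\<dots> = prob (\<Union>e\<in>E. {\<omega> \<in> space M. Y t \<omega> = e})"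
      by (rule finite_measure_finite_Union[symmetric]) (use E ev in \<open>auto simp: disjoint_family_on_def\<close>)
    also have "(\<Union>e\<in>E. {\<omega> \<in> space M. Y t \<omega> = e}) = {\<omega> \<in> space M. Y t \<omega> \<in> E}" by auto
    finally have "real (card E) * p \<le> prob {\<omega> \<in> space M. Y t \<omega> \<in> E}" .
    moreover have "Y t -` (two_subsets - E) \<inter> space M = space M - {\<omega> \<in> space M. Y t \<omega> \<in> E}"
      using Y_two_subsets[OF t] by auto
    then have "prob (Y t -` (two_subsets - E) \<inter> space M) = 1 - prob {\<omega> \<in> space M. Y t \<omega> \<in> E}"
      using prob_compl[OF Y_event[OF t]] by simp
    ultimately have "prob (Y t -` (two_subsets - E) \<inter> space M) \<le> 1 + (- (real (card E) * p))" by simp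
    also have "\<dots> \<le> exp (- (real (card E) * p))" by (rule exp_ge_add_one_self)
    finally show ?thesis .
  qed
  have "{\<omega> \<in> space M. \<forall>t\<in>{1..m}. Y t \<omega> \<notin> E} = (\<Inter>t\<in>{1..m}. Y t -` (two_subsets - E) \<inter> space M)"
    using Y_two_subsets m by auto
  also have "prob \<dots> = (\<Prod>t\<in>{1..m}. prob (Y t -` (two_subsets - E) \<inter> space M))"
    by (rule indep_varsD[OF indep]) (use m in auto)
  also have "\<dots> \<le> (\<Prod>t\<in>{1..m}. exp (- (real (card E) * p)))"
    by (rule prod_mono) (use one in auto)
  also have "\<dots> = exp (- (real m * real (card E) * p))"
    by (simp add: exp_of_nat_mult[symmetric])
  finally show ?thesis .
qed

lemma hits_event:
  "{\<omega> \<in> space M. x \<le> real (card {t \<in> {1..m}. Y t \<omega> \<in> E})} \<in> events"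
proof -
  have "(\<lambda>\<omega>. \<Sum>t\<in>{1..m}. indicator {\<omega> \<in> space M. Y t \<omega> \<in> E} \<omega> :: real) \<in> borel_measurable M"
    by (intro borel_measurable_sum borel_measurable_indicator Y_event) auto
  then have "{\<omega> \<in> space M. x \<le> (\<Sum>t\<in>{1..m}. indicator {\<omega> \<in> space M. Y t \<omega> \<in> E} \<omega> :: real)} \<in> events"
    by measurable
  also have "{\<omega> \<in> space M. x \<le> (\<Sum>t\<in>{1..m}. indicator {\<omega> \<in> space M. Y t \<omega> \<in> E} \<omega> :: real)}
     = {\<omega> \<in> space M. x \<le> real (card {t \<in> {1..m}. Y t \<omega> \<in> E})}"
    by (auto simp: indicator_def sum.If_cases Int_def)
  finally show ?thesis .
qed

text \<open>Chernoff's method with exponent 1: the exponential moment of the number of hits factorises over the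
draws, and each factor is at most \<open>1 + (exp 1 - 1) * p \<le> exp (2 * p)\<close>.\<close>

lemma prob_many_hits_le:
  assumes p: "\<And>t. t \<ge> 1 \<Longrightarrow> prob {\<omega> \<in> space M. Y t \<omega> \<in> E} \<le> p"
  shows "prob {\<omega> \<in> space M. x \<le> real (card {t \<in> {1..m}. Y t \<omega> \<in> E})} \<le> exp (2 * (real m * p) - x)"
proof -
  define f where "f e = (if e \<in> E then exp 1 else 1 :: real)" for e
  have f_alt: "f (Y t \<omega>) = 1 + (exp 1 - 1) * indicator {\<omega> \<in> space M. Y t \<omega> \<in> E} \<omega>"
    if "\<omega> \<in> space M" for t \<omega>
    using that by (simp add: f_def)
  have ind: "indep_vars (\<lambda>_. borel) (\<lambda>t \<omega>. f (Y t \<omega>)) {1..m}"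
    by (rule indep_vars_compose2[OF indep_vars_subset[OF indep]]) auto
  have int: "integrable M (\<lambda>\<omega>. f (Y t \<omega>))" if "t \<ge> 1" for t
  proof (rule iffD2[OF Bochner_Integration.integrable_cong[OF refl f_alt]])
    have "integrable M (indicator {\<omega> \<in> space M. Y t \<omega> \<in> E} :: 'a \<Rightarrow> real)"
      using Y_event[OF that] by (simp add: emeasure_eq_measure)
    then show "integrable M (\<lambda>\<omega>. 1 + (exp 1 - 1) * indicator {\<omega> \<in> space M. Y t \<omega> \<in> E} \<omega> :: real)"
      by (intro Bochner_Integration.integrable_add integrable_mult_right) simp_all
  qed
  have exp_f: "expectation (\<lambda>\<omega>. f (Y t \<omega>)) \<le> exp (2 * p)" if t: "t \<ge> 1" for t
  proof -
    have "expectation (\<lambda>\<omega>. f (Y t \<omega>))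
      = expectation (\<lambda>\<omega>. 1 + (exp 1 - 1) * indicator {\<omega> \<in> space M. Y t \<omega> \<in> E} \<omega>)"
      by (rule Bochner_Integration.integral_cong[OF refl f_alt])
    also have "\<dots> = 1 + (exp 1 - 1) * prob {\<omega> \<in> space M. Y t \<omega> \<in> E}"
      using Y_event[OF t, of E]
      by (subst Bochner_Integration.integral_add)
         (auto simp: prob_space emeasure_eq_measure Int_absorb2 intro!: integrable_mult_right)
    also have "\<dots> \<le> 1 + 2 * p"
      using p[OF t] exp_le by (intro add_left_mono mult_mono) auto
    also have "\<dots> \<le> exp (2 * p)" by (rule exp_ge_add_one_self)
    finally show ?thesis .
  qed
  have prod_f: "(\<Prod>t\<in>{1..m}. f (Y t \<omega>)) = exp (real (card {t \<in> {1..m}. Y t \<omega> \<in> E}))" for \<omega>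
    by (simp add: f_def prod.If_cases Int_def exp_of_nat_mult[symmetric])
  have "prob {\<omega> \<in> space M. x \<le> real (card {t \<in> {1..m}. Y t \<omega> \<in> E})}
    = prob {\<omega> \<in> space M. (\<Prod>t\<in>{1..m}. f (Y t \<omega>)) \<ge> exp x}"
    by (simp only: prod_f exp_le_cancel_iff)
  also have "\<dots> \<le> expectation (\<lambda>\<omega>. \<Prod>t\<in>{1..m}. f (Y t \<omega>)) / exp x"
  proof (rule integral_Markov_inequality_measure[of _ _ "{}"])
    show "integrable M (\<lambda>\<omega>. \<Prod>t\<in>{1..m}. f (Y t \<omega>))"
      by (rule indep_vars_integrable[OF _ ind]) (use int in auto)
    show "AE \<omega> in M. 0 \<le> (\<Prod>t\<in>{1..m}. f (Y t \<omega>))"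
      by (simp only: prod_f) simp
  qed auto
  also have "expectation (\<lambda>\<omega>. \<Prod>t\<in>{1..m}. f (Y t \<omega>)) = (\<Prod>t\<in>{1..m}. expectation (\<lambda>\<omega>. f (Y t \<omega>)))"
    by (rule indep_vars_lebesgue_integral[OF _ ind]) (use int in auto)
  also have "\<dots> \<le> (\<Prod>t\<in>{1..m}. exp (2 * p))"
    by (rule prod_mono) (use exp_f in \<open>auto simp: f_def intro!: Bochner_Integration.integral_nonneg\<close>)
  also have "\<dots> = exp (2 * (real m * p))"
    by (simp add: exp_of_nat_mult[symmetric] algebra_simps)
  finally show ?thesis by (simp add: exp_diff divide_right_mono)
qed

end

section \<open>Edges with power-law probabilities\<close>

text \<open>The normalised weights \<open>mu q i j / mu_norm q\<close> enter only through these two bounds.\<close>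

locale power_law_edges = indep_edges +
  fixes \<gamma> b B :: real
  assumes gamma: "\<gamma> > 1" and B: "B > 0"
    and edge_prob_lower: "\<And>t i j. t \<ge> 1 \<Longrightarrow> i \<ge> 1 \<Longrightarrow> i < j \<Longrightarrow>
      b * (real i * real j) powr (- \<gamma>) \<le> prob {\<omega> \<in> space M. Y t \<omega> = {i, j}}"
    and edge_prob_upper: "\<And>t i j. t \<ge> 1 \<Longrightarrow> i \<ge> 1 \<Longrightarrow> i < j \<Longrightarrow>
      prob {\<omega> \<in> space M. Y t \<omega> = {i, j}} \<le> B * (real i * real j) powr (- \<gamma>)"
begin

lemma edge_prob:
  assumes "t \<ge> 1" "i \<ge> 1" "j \<ge> 1" "i \<noteq> j"
  shows "b * (real i * real j) powr (- \<gamma>) \<le> prob {\<omega> \<in> space M. Y t \<omega> = {i, j}}"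
    and "prob {\<omega> \<in> space M. Y t \<omega> = {i, j}} \<le> B * (real i * real j) powr (- \<gamma>)"
  using assms edge_prob_lower[of t i j] edge_prob_lower[of t j i]
    edge_prob_upper[of t i j] edge_prob_upper[of t j i]
  by (cases "i < j"; simp add: insert_commute mult.commute)+

definition tail_const :: real where
  "tail_const = 2 powr \<gamma> / (\<gamma> - 1)"

lemma tail_const_pos: "tail_const > 0" using gamma by (simp add: tail_const_def)

text \<open>Union bound over all pairs \<open>{i, j}\<close> with \<open>i > L\<close> and \<open>j > K\<close>.  The bound on the probability of a pair
factorises, so the double sum is a product of two tails.\<close>

lemma prob_far_le:
  assumes t: "t \<ge> 1"
  shows "prob {\<omega> \<in> space M. Y t \<omega> \<in> far_edges L K}
    \<le> B * tail_const\<^sup>2 * (real (Suc L) * real (Suc K)) powr (1 - \<gamma>)"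
proof -
  define A where "A i j = {\<omega> \<in> space M. Suc L + i \<noteq> Suc K + j \<and> Y t \<omega> = {Suc L + i, Suc K + j}}" for i j
  define u where "u i = real (Suc L + i) powr (- \<gamma>)" for i
  define v where "v j = real (Suc K + j) powr (- \<gamma>)" for j
  have ev: "A i j \<in> events" for i j
    using Y_event[OF t, of "{{Suc L + i, Suc K + j}}"] by (cases "Suc L + i = Suc K + j") (auto simp: A_def)
  have pA: "prob (A i j) \<le> B * u i * v j" for i j
  proof (cases "Suc L + i = Suc K + j")
    case True
    then show ?thesis using B by (simp add: A_def u_def v_def)
  next
    case False
    then have "prob (A i j) \<le> B * (real (Suc L + i) * real (Suc K + j)) powr (- \<gamma>)"
      using edge_prob(2)[OF t, of "Suc L + i" "Suc K + j"] by (simp add: A_def)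
    then show ?thesis by (simp add: u_def v_def powr_mult mult.assoc)
  qed
  have su: "summable u" and u: "suminf u \<le> tail_const * real (Suc L) powr (1 - \<gamma>)"
    unfolding u_def tail_const_def by (rule powr_tail_sum[OF gamma]; simp)+
  have sv: "summable v" and v: "suminf v \<le> tail_const * real (Suc K) powr (1 - \<gamma>)"
    unfolding v_def tail_const_def by (rule powr_tail_sum[OF gamma]; simp)+
  have u0: "u i \<ge> 0" for i by (simp add: u_def)
  have inner: "prob (\<Union>j. A i j) \<le> B * u i * suminf v" for i
  proof -
    have sm: "summable (\<lambda>j. B * u i * v j)" using sv by (rule summable_mult)
    have sp: "summable (\<lambda>j. prob (A i j))"
      by (rule summable_comparison_test'[OF sm, of 0]) (use pA in auto)
    have "prob (\<Union>j. A i j) \<le> (\<Sum>j. prob (A i j))"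
      by (rule finite_measure_subadditive_countably[OF _ sp]) (use ev in auto)
    also have "\<dots> \<le> (\<Sum>j. B * u i * v j)" by (rule suminf_le[OF pA sp sm])
    also have "\<dots> = B * u i * suminf v" by (rule suminf_mult[OF sv])
    finally show ?thesis .
  qed
  have sm: "summable (\<lambda>i. B * u i * suminf v)" by (intro summable_mult summable_mult2 su)
  have sp: "summable (\<lambda>i. prob (\<Union>j. A i j))"
    by (rule summable_comparison_test'[OF sm, of 0]) (use inner in auto)
  have "{\<omega> \<in> space M. Y t \<omega> \<in> far_edges L K} = (\<Union>i. \<Union>j. A i j)"
  proof (intro set_eqI iffI)
    fix \<omega> assume *: "\<omega> \<in> {\<omega> \<in> space M. Y t \<omega> \<in> far_edges L K}"
    then obtain i j where ij: "L < i" "K < j" "i \<noteq> j" "Y t \<omega> = {i, j}" by (auto simp: far_edges_def)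
    then have "\<omega> \<in> A (i - Suc L) (j - Suc K)" using * by (simp add: A_def)
    then show "\<omega> \<in> (\<Union>i. \<Union>j. A i j)" by blast
  next
    fix \<omega> assume "\<omega> \<in> (\<Union>i. \<Union>j. A i j)"
    then obtain i j where "\<omega> \<in> A i j" by blast
    then show "\<omega> \<in> {\<omega> \<in> space M. Y t \<omega> \<in> far_edges L K}"
      using far_edgesI[of L "Suc L + i" K "Suc K + j"] by (simp add: A_def)
  qed
  also have "prob (\<Union>i. \<Union>j. A i j) \<le> (\<Sum>i. prob (\<Union>j. A i j))"
    by (rule finite_measure_subadditive_countably[OF _ sp]) (use ev in auto)
  also have "\<dots> \<le> (\<Sum>i. B * u i * suminf v)" by (rule suminf_le[OF inner sp sm])
  also have "\<dots> = B * suminf u * suminf v"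
    by (simp only: suminf_mult2[OF summable_mult[OF su], symmetric] suminf_mult[OF su])
  also have "\<dots> \<le> B * (tail_const * real (Suc L) powr (1 - \<gamma>)) * (tail_const * real (Suc K) powr (1 - \<gamma>))"
    using u v B tail_const_pos suminf_nonneg[OF su u0] suminf_nonneg[OF sv] by (intro mult_mono mult_nonneg_nonneg) (auto simp: v_def)
  also have "\<dots> = B * tail_const\<^sup>2 * (real (Suc L) * real (Suc K)) powr (1 - \<gamma>)"
    by (simp add: powr_mult power2_eq_square)
  finally show ?thesis .
qed

end

lemma rank1_graph_eq:
  "rank1_graph Y m \<omega> = (\<Union>((\<lambda>t. Y t \<omega>) ` {1..m}), (\<lambda>t. Y t \<omega>) ` {1..m})"
  by (simp add: rank1_graph_def)

context power_law_edges
begin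

text \<open>The scale of the graph after \<open>m\<close> draws: the expected number of occurrences of the pair
\<open>{i, j}\<close> is of order \<open>(N m / (i * j)) powr \<gamma>\<close>, so it is likely to be an edge exactly when \<open>i * j\<close> is at most of order
\<open>N m\<close>, and vertex \<open>i\<close> has degree of order \<open>N m / i\<close>.\<close>

abbreviation N :: "nat \<Rightarrow> real" where "N m \<equiv> real m powr (1 / \<gamma>)"

lemma N_facts:
  assumes "m \<ge> 1"
  shows "N m \<le> real m" "N m powr (- \<gamma>) = 1 / real m" "real m * N m powr (1 - \<gamma>) = N m"
proof -
  show "N m \<le> real m" using assms gamma powr_mono[of "1 / \<gamma>" 1 "real m"] by simp
  have "N m powr \<gamma> = real m" using assms gamma by (simp add: powr_powr)
  then show "N m powr (- \<gamma>) = 1 / real m" "real m * N m powr (1 - \<gamma>) = N m"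
    using assms by (simp_all add: powr_minus powr_diff field_simps)
qed

lemma edges_two_subsets:
  "\<omega> \<in> space M \<Longrightarrow> (\<lambda>t. Y t \<omega>) ` {1..m} \<subseteq> two_subsets"
  using Y_two_subsets by auto

text \<open>The exceptional event for the upper bound.  The far edges \<open>{i, j}\<close> have \<open>i > 2 * N m / k\<close> and
\<open>j > k / 2\<close>, so \<open>i * j\<close> exceeds \<open>N m\<close> and \<open>prob_far_le\<close> gives an expected number of
draws among them of at most \<open>B * tail_const\<^sup>2 * N m\<close>, whatever \<open>k\<close> is.  The threshold is twice that,
as the exponential moment loses a factor 2, plus the \<open>N m\<close> that becomes the exponent in
\<open>prob_crowded\<close>.\<close>

definition crowded :: "nat \<Rightarrow> nat \<Rightarrow> 'a set" where
  "crowded m k = {\<omega> \<in> space M. (2 * B * tail_const\<^sup>2 + 1) * N m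
     \<le> real (card {t \<in> {1..m}. Y t \<omega> \<in> far_edges (nat \<lfloor>2 * N m / real k\<rfloor>) (k div 2)})}"

lemma prob_crowded:
  assumes m: "m \<ge> 1" and k: "k \<ge> 1"
  shows "prob (crowded m k) \<le> exp (- N m)"
proof -
  define L where "L = nat \<lfloor>2 * N m / real k\<rfloor>"
  define K where "K = k div 2"
  have "real (Suc L) \<ge> 2 * N m / real k" unfolding L_def by linarith
  moreover have "real (Suc K) \<ge> real k / 2" unfolding K_def by linarith
  ultimately have "2 * N m / real k * (real k / 2) \<le> real (Suc L) * real (Suc K)"
    using k by (intro mult_mono) auto
  then have "N m \<le> real (Suc L) * real (Suc K)" using k by simp
  then have "(real (Suc L) * real (Suc K)) powr (1 - \<gamma>) \<le> N m powr (1 - \<gamma>)"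
    using gamma m by (intro powr_mono2') auto
  then have p: "B * tail_const\<^sup>2 * (real (Suc L) * real (Suc K)) powr (1 - \<gamma>) \<le> B * tail_const\<^sup>2 * N m powr (1 - \<gamma>)"
    using B by (intro mult_left_mono) auto
  have "prob (crowded m k)
    \<le> exp (2 * (real m * (B * tail_const\<^sup>2 * N m powr (1 - \<gamma>))) - (2 * B * tail_const\<^sup>2 + 1) * N m)"
    unfolding crowded_def L_def[symmetric] K_def[symmetric]
    by (rule prob_many_hits_le) (rule order_trans[OF prob_far_le p])
  also have "2 * (real m * (B * tail_const\<^sup>2 * N m powr (1 - \<gamma>))) = 2 * B * tail_const\<^sup>2 * (real m * N m powr (1 - \<gamma>))"
    by simp
  finally show ?thesis by (simp only: N_facts(3)[OF m]) (simp add: algebra_simps)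
qed

lemma num_vertices_ge_le:
  assumes \<omega>: "\<omega> \<in> space M" and k: "k \<ge> 1" and not_crowded: "\<omega> \<notin> crowded m k"
  shows "real (num_vertices_ge k (rank1_graph Y m \<omega>)) * real k \<le> (8 * B * tail_const\<^sup>2 + 6) * N m"
proof -
  define L where "L = nat \<lfloor>2 * N m / real k\<rfloor>"
  define F where "F = (\<lambda>t. Y t \<omega>) ` {1..m}"
  define far where "far = far_edges L (k div 2)"
  have "num_vertices_ge k (\<Union>F, F) * k \<le> L * k + 4 * card {e \<in> F. e \<in> far}"
    unfolding far_def
    by (rule num_vertices_ge_upper) (use edges_two_subsets[OF \<omega>] k in \<open>auto simp: F_def\<close>)
  also have "{e \<in> F. e \<in> far} = (\<lambda>t. Y t \<omega>) ` {t \<in> {1..m}. Y t \<omega> \<in> far}"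
    by (auto simp: F_def)
  also have "card \<dots> \<le> card {t \<in> {1..m}. Y t \<omega> \<in> far}"
    by (rule card_image_le) simp
  finally have "num_vertices_ge k (\<Union>F, F) * k \<le> L * k + 4 * card {t \<in> {1..m}. Y t \<omega> \<in> far}"
    by simp
  then have "real (num_vertices_ge k (\<Union>F, F) * k) \<le> real (L * k + 4 * card {t \<in> {1..m}. Y t \<omega> \<in> far})"
    by (simp only: of_nat_le_iff)
  moreover have "real (card {t \<in> {1..m}. Y t \<omega> \<in> far}) \<le> (2 * B * tail_const\<^sup>2 + 1) * N m"
    using not_crowded \<omega> by (simp add: crowded_def far_def L_def)
  moreover have "real L \<le> 2 * N m / real k" unfolding L_def by simp
  then have "real L * real k \<le> 2 * N m" using k by (simp add: field_simps)
  ultimately show ?thesis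
    unfolding rank1_graph_eq F_def[symmetric] by (simp add: algebra_simps)
qed

text \<open>The exceptional event for the lower bound: a fixed proportion of the near edges of the rectangle
\<open>{1..I} \<times> {1..2 * k}\<close> is never drawn.  It is written as a union over the possible sets \<open>S\<close> of undrawn
edges, so that it can be bounded without any knowledge of the correlations between edges.\<close>

definition hollow :: "real \<Rightarrow> nat \<Rightarrow> nat \<Rightarrow> 'a set" where
  "hollow a m k = (let I = nat \<lfloor>a * N m / real k\<rfloor> in
     \<Union>S\<in>{S. S \<subseteq> near_edges I (2 * k) \<and> I * k \<le> 4 * card S}.
       {\<omega> \<in> space M. \<forall>t\<in>{1..m}. Y t \<omega> \<notin> S})"

lemma finite_hollow_index:
  "finite {S. S \<subseteq> near_edges I J \<and> n \<le> 4 * card S}"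
  by (rule finite_subset[of _ "Pow (near_edges I J)"]) (auto simp: finite_near_edges)

lemma hollow_event: "hollow a m k \<in> events"
  unfolding hollow_def Let_def by (intro sets.finite_UN finite_hollow_index avoid_event)

lemma half_le_floor: 
  fixes x :: real
  assumes "x \<ge> 1" shows "x / 2 \<le> real (nat \<lfloor>x\<rfloor>)"
proof -
  have "\<lfloor>x\<rfloor> \<ge> 1" using assms by simp
  then have "real (nat \<lfloor>x\<rfloor>) = of_int \<lfloor>x\<rfloor>" "of_int \<lfloor>x\<rfloor> \<ge> (1 :: real)" by simp_all
  moreover have "x < of_int \<lfloor>x\<rfloor> + 1" by simp
  ultimately show ?thesis by linarith
qed

text \<open>On the rectangle \<open>i * j \<le> 2 * a * N m\<close>, so every near edge has probability at least \<open>12 / m\<close>.  Avoiding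
a set of at least \<open>I * k / 4\<close> of them costs \<open>exp (- 3 * I * k)\<close>, which beats the number of sets, at
most \<open>2 ^ (2 * I * k) \<le> exp (2 * I * k)\<close>; this is where the constant 12 comes from.\<close>

lemma prob_hollow:
  assumes m: "m \<ge> 1" and k: "k \<ge> 1" and ka: "real k \<le> a * N m"
    and a: "a > 0" "b * (2 * a) powr (- \<gamma>) \<ge> 12"
  shows "prob (hollow a m k) \<le> exp (- (a / 2 * N m))"
proof -
  define I where "I = nat \<lfloor>a * N m / real k\<rfloor>"
  define \<S> where "\<S> = {S. S \<subseteq> near_edges I (2 * k) \<and> I * k \<le> 4 * card S}"
  define avoid where "avoid S = {\<omega> \<in> space M. \<forall>t\<in>{1..m}. Y t \<omega> \<notin> S}" for S
  have Ik_upper: "real I * real k \<le> a * N m"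
  proof -
    have "real I \<le> a * N m / real k" unfolding I_def using a by simp
    then show ?thesis using k by (simp add: field_simps)
  qed
  have Ik_lower: "a / 2 * N m \<le> real I * real k"
  proof -
    have "a * N m / real k / 2 \<le> real I"
      unfolding I_def by (rule half_le_floor) (use k ka in \<open>simp add: field_simps\<close>)
    then show ?thesis using k by (simp add: field_simps)
  qed
  have edge: "12 / real m \<le> prob {\<omega> \<in> space M. Y t \<omega> = e}"
    if t: "t \<ge> 1" and e: "e \<in> near_edges I (2 * k)" for t e
  proof -
    obtain i j where ij: "e = {i, j}" "1 \<le> i" "i \<le> I" "1 \<le> j" "j \<le> 2 * k" "i \<noteq> j"
      using e by (auto simp: near_edges_def)
    have "b * (2 * a) powr (- \<gamma>) > 0" using a by linarith
    then have b: "b > 0" by (simp add: zero_less_mult_iff)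
    have "real i * real j \<le> real I * real (2 * k)"
      using ij by (intro mult_mono of_nat_mono) auto
    also have "\<dots> \<le> 2 * a * N m" using Ik_upper by simp
    finally have "(2 * a * N m) powr (- \<gamma>) \<le> (real i * real j) powr (- \<gamma>)"
      using ij gamma by (intro powr_mono2') auto
    then have "b * (2 * a * N m) powr (- \<gamma>) \<le> b * (real i * real j) powr (- \<gamma>)"
      using b by simp
    also have "\<dots> \<le> prob {\<omega> \<in> space M. Y t \<omega> = e}"
      using edge_prob(1)[OF t ij(2,4,6)] by (simp add: ij(1))
    finally have "b * (2 * a * N m) powr (- \<gamma>) \<le> prob {\<omega> \<in> space M. Y t \<omega> = e}" .
    moreover have "b * (2 * a * N m) powr (- \<gamma>) = b * (2 * a) powr (- \<gamma>) / real m"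
      using a N_facts(2)[OF m] by (simp add: powr_mult)
    moreover have "12 / real m \<le> b * (2 * a) powr (- \<gamma>) / real m"
      using a by (intro divide_right_mono) auto
    ultimately show ?thesis by linarith
  qed
  have avoid: "prob (avoid S) \<le> exp (- 3 * real (I * k))" if S: "S \<in> \<S>" for S
  proof -
    have "prob (avoid S) \<le> exp (- (real m * real (card S) * (12 / real m)))"
      unfolding avoid_def
      by (rule prob_avoid_le[OF m])
         (use S edge in \<open>auto simp: \<S>_def intro: finite_subset[OF _ finite_near_edges]\<close>)
    also have "\<dots> \<le> exp (- 3 * real (I * k))"
    proof -
      have "I * k \<le> 4 * card S" using S by (simp add: \<S>_def)
      then have "real (I * k) \<le> 4 * real (card S)" by linarith
      then show ?thesis using m by simp
    qed
    finally show ?thesis .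
  qed
  have fin: "finite \<S>" unfolding \<S>_def by (rule finite_hollow_index)
  have "card \<S> \<le> card (Pow (near_edges I (2 * k)))"
    by (intro card_mono) (auto simp: finite_near_edges \<S>_def)
  also have "\<dots> = 2 ^ card (near_edges I (2 * k))" by (simp add: card_Pow finite_near_edges)
  also have "\<dots> \<le> 2 ^ (I * (2 * k))" by (rule power_increasing[OF card_near_edges]) simp
  finally have "real (card \<S>) \<le> 2 ^ (I * (2 * k))" using of_nat_mono by fastforce
  also have "\<dots> \<le> exp 1 ^ (I * (2 * k))"
    using exp_ge_add_one_self[of 1] by (intro power_mono) auto
  also have "\<dots> = exp (2 * real (I * k))" by (simp add: exp_of_nat_mult[symmetric] algebra_simps)
  finally have card: "real (card \<S>) \<le> exp (2 * real (I * k))" .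
  have "prob (hollow a m k) = prob (\<Union>S\<in>\<S>. avoid S)"
    by (simp add: hollow_def Let_def I_def \<S>_def avoid_def)
  also have "\<dots> \<le> (\<Sum>S\<in>\<S>. prob (avoid S))"
    by (rule finite_measure_subadditive_finite[OF fin]) (use avoid_event in \<open>auto simp: avoid_def\<close>)
  also have "\<dots> \<le> real (card \<S>) * exp (- 3 * real (I * k))"
    using sum_bounded_above[OF avoid] by simp
  also have "\<dots> \<le> exp (2 * real (I * k)) * exp (- 3 * real (I * k))"
    using card by (rule mult_right_mono) simp
  also have "\<dots> = exp (- real (I * k))" by (simp add: exp_add[symmetric])
  also have "\<dots> \<le> exp (- (a / 2 * N m))" using Ik_lower by simp
  finally show ?thesis .
qed

lemma num_vertices_ge_ge:
  assumes \<omega>: "\<omega> \<in> space M" and k: "k \<ge> 1" "real k \<le> a * N m" and not_hollow: "\<omega> \<notin> hollow a m k"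
  shows "a / 4 * N m \<le> real (num_vertices_ge k (rank1_graph Y m \<omega>)) * real k"
proof -
  define x where "x = a * N m / real k"
  define I where "I = nat \<lfloor>x\<rfloor>"
  define F where "F = (\<lambda>t. Y t \<omega>) ` {1..m}"
  have "\<not> 2 * num_vertices_ge k (\<Union>F, F) < I"
  proof
    assume "2 * num_vertices_ge k (\<Union>F, F) < I"
    then have "I * k \<le> 4 * card (near_edges I (2 * k) - F)"
      by (intro many_missing_edges) (use edges_two_subsets[OF \<omega>] k in \<open>auto simp: F_def\<close>)
    moreover have "\<forall>t\<in>{1..m}. Y t \<omega> \<notin> near_edges I (2 * k) - F" by (auto simp: F_def)
    ultimately have "\<omega> \<in> hollow a m k"
      unfolding hollow_def Let_def x_def[symmetric] I_def[symmetric] using \<omega>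
      by (intro UN_I[of "near_edges I (2 * k) - F"]) auto
    with not_hollow show False by contradiction
  qed
  then have "real I / 2 \<le> real (num_vertices_ge k (\<Union>F, F))" by linarith
  moreover have "x / 2 \<le> real I"
    unfolding I_def by (rule half_le_floor) (use k in \<open>simp add: x_def field_simps\<close>)
  ultimately have "x / 4 \<le> real (num_vertices_ge k (\<Union>F, F))" by linarith
  then show ?thesis
    using k unfolding rank1_graph_eq F_def[symmetric] by (simp add: x_def field_simps)
qed

lemma num_vertices_ge_eq_0:
  assumes "m < k"
  shows "num_vertices_ge k (rank1_graph Y m \<omega>) = 0"
proof -
  have "vertex_degree (rank1_graph Y m \<omega>) x < k" for x
  proof -
    have "vertex_degree (rank1_graph Y m \<omega>) x \<le> card ((\<lambda>t. Y t \<omega>) ` {1..m})"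
      unfolding vertex_degree_def rank1_graph_eq by (intro card_mono) auto
    also have "\<dots> \<le> m" using card_image_le[of "{1..m}" "\<lambda>t. Y t \<omega>"] by simp
    finally show ?thesis using assms by simp
  qed
  then have "{x \<in> fst (rank1_graph Y m \<omega>). k \<le> vertex_degree (rank1_graph Y m \<omega>) x} = {}"
    by (auto simp: not_le)
  then show ?thesis by (simp only: num_vertices_ge_def card.empty)
qed

text \<open>Borel-Cantelli for the union of the exceptional events over \<open>k\<close>.  Degrees \<open>k > m\<close> do not occur, so
at most \<open>m\<close> values of \<open>k\<close> matter in each of the two bounds.\<close>

lemma AE_num_vertices_ge:
  assumes a: "a > 0" "a \<le> 1" "b * (2 * a) powr (- \<gamma>) \<ge> 12"
  shows "AE \<omega> in M. \<forall>\<^sub>F m in sequentially. \<forall>k\<ge>1.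
    real (num_vertices_ge k (rank1_graph Y m \<omega>)) * real k \<le> (8 * B * tail_const\<^sup>2 + 6) * N m \<and>
    (real k \<le> a * N m \<longrightarrow>
      a / 4 * N m \<le> real (num_vertices_ge k (rank1_graph Y m \<omega>)) * real k)"
proof -
  define bad where "bad m = (\<Union>k\<in>{1..m}. crowded m k)
    \<union> (\<Union>k\<in>{k\<in>{1..m}. real k \<le> a * N m}. hollow a m k)" for m
  have crowded: "crowded m k \<in> events" for m k unfolding crowded_def by (rule hits_event)
  have bad_events: "bad m \<in> events" for m
    unfolding bad_def using crowded hollow_event by (intro sets.Un sets.finite_UN) auto
  have prob_bad: "prob (bad m) \<le> 2 * (real m * exp (- (a / 2) * N m))" for m
  proof (cases "m \<ge> 1")
    case False
    then have "m = 0" by simp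
    then show ?thesis by (simp add: bad_def)
  next
    case m: True
    have N: "N m \<ge> 0" by simp
    have "prob (\<Union>k\<in>{1..m}. crowded m k) \<le> (\<Sum>k\<in>{1..m}. prob (crowded m k))"
      by (rule finite_measure_subadditive_finite) (use crowded in auto)
    also have "\<dots> \<le> real m * exp (- N m)"
      using sum_bounded_above[of "{1..m}" "\<lambda>k. prob (crowded m k)" "exp (- N m)"] prob_crowded[OF m] by simp
    also have "\<dots> \<le> real m * exp (- (a / 2) * N m)"
      using mult_right_mono[OF _ N, of "a / 2" 1] a by (intro mult_left_mono) auto
    finally have 1: "prob (\<Union>k\<in>{1..m}. crowded m k) \<le> real m * exp (- (a / 2) * N m)" .
    have "prob (\<Union>k\<in>{k\<in>{1..m}. real k \<le> a * N m}. hollow a m k)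
      \<le> (\<Sum>k\<in>{k\<in>{1..m}. real k \<le> a * N m}. prob (hollow a m k))"
      by (rule finite_measure_subadditive_finite) (use hollow_event in auto)
    also have "\<dots> \<le> (\<Sum>k\<in>{k\<in>{1..m}. real k \<le> a * N m}. exp (- (a / 2) * N m))"
      by (rule sum_mono) (use prob_hollow[OF m] a in auto)
    also have "\<dots> \<le> (\<Sum>k\<in>{1..m}. exp (- (a / 2) * N m))"
      by (rule sum_mono2) auto
    also have "\<dots> = real m * exp (- (a / 2) * N m)" by simp
    finally have 2: "prob (\<Union>k\<in>{k\<in>{1..m}. real k \<le> a * N m}. hollow a m k)
      \<le> real m * exp (- (a / 2) * N m)" .
    have "prob (bad m) \<le> prob (\<Union>k\<in>{1..m}. crowded m k)
      + prob (\<Union>k\<in>{k\<in>{1..m}. real k \<le> a * N m}. hollow a m k)"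
      unfolding bad_def using crowded hollow_event
      by (intro measure_Un_le sets.finite_UN) auto
    with 1 2 show ?thesis by linarith
  qed
  have "summable (\<lambda>m. 2 * (real m * exp (- (a / 2) * N m)))"
    by (intro summable_mult summable_stretched_exponential) (use a gamma in auto)
  then have "summable (\<lambda>m. prob (bad m))"
    by (rule summable_comparison_test') (use prob_bad in auto)
  then have "AE \<omega> in M. \<forall>\<^sub>F m in sequentially. \<omega> \<in> space M - bad m"
    by (intro borel_cantelli_AE1 bad_events) (auto simp: emeasure_eq_measure)
  then show ?thesis
  proof (eventually_elim)
    fix \<omega> assume *: "\<forall>\<^sub>F m in sequentially. \<omega> \<in> space M - bad m"
    show "\<forall>\<^sub>F m in sequentially. \<forall>k\<ge>1.
      real (num_vertices_ge k (rank1_graph Y m \<omega>)) * real k \<le> (8 * B * tail_const\<^sup>2 + 6) * N m \<and>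
      (real k \<le> a * N m \<longrightarrow>
        a / 4 * N m \<le> real (num_vertices_ge k (rank1_graph Y m \<omega>)) * real k)"
      using * eventually_ge_at_top[of 1]
    proof eventually_elim
      fix m assume \<omega>: "\<omega> \<in> space M - bad m" and m: "m \<ge> 1"
      show "\<forall>k\<ge>1. real (num_vertices_ge k (rank1_graph Y m \<omega>)) * real k \<le> (8 * B * tail_const\<^sup>2 + 6) * N m \<and>
        (real k \<le> a * N m \<longrightarrow>
          a / 4 * N m \<le> real (num_vertices_ge k (rank1_graph Y m \<omega>)) * real k)"
      proof (intro allI impI conjI)
        fix k :: nat assume k: "k \<ge> 1"
        show "real (num_vertices_ge k (rank1_graph Y m \<omega>)) * real k \<le> (8 * B * tail_const\<^sup>2 + 6) * N m"
        proof (cases "k \<le> m")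
          case True
          then show ?thesis using \<omega> k by (intro num_vertices_ge_le) (auto simp: bad_def)
        next
          case False
          then show ?thesis using B by (simp add: num_vertices_ge_eq_0)
        qed
        assume ka: "real k \<le> a * N m"
        also have "\<dots> \<le> 1 * real m" using a N_facts(1)[OF m] by (intro mult_mono) auto
        finally have "k \<le> m" by simp
        then show "a / 4 * N m \<le> real (num_vertices_ge k (rank1_graph Y m \<omega>)) * real k"
          using \<omega> k ka by (intro num_vertices_ge_ge) (auto simp: bad_def)
      qed
    qed
  qed
qed

end

section \<open>The degree distribution\<close>

lemma num_vertices_eq:
  "num_vertices (rank1_graph Y m \<omega>) = num_vertices_ge 1 (rank1_graph Y m \<omega>)"
proof -
  have "1 \<le> vertex_degree (rank1_graph Y m \<omega>) x" if x: "x \<in> fst (rank1_graph Y m \<omega>)" for x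
  proof -
    have "{e \<in> snd (rank1_graph Y m \<omega>). x \<in> e} \<noteq> {}" using x by (auto simp: rank1_graph_eq)
    moreover have "finite {e \<in> snd (rank1_graph Y m \<omega>). x \<in> e}" by (simp add: rank1_graph_eq)
    ultimately show ?thesis by (simp add: vertex_degree_def Suc_le_eq card_gt_0_iff)
  qed
  then show ?thesis
    unfolding num_vertices_def num_vertices_ge_def by (intro arg_cong[where f = card]) auto
qed

text \<open>Every vertex has degree at least 1, so the case \<open>k = 1\<close> of the two-sided bound on the number of vertices
of large degree shows that the number of all vertices is of order \<open>N m\<close>; dividing by it gives both
claims.\<close>

lemma (in power_law_edges) AE_prop_ge:
  assumes a: "a > 0" "a \<le> 1" "b * (2 * a) powr (- \<gamma>) \<ge> 12"
  defines "c \<equiv> a / 4 / (8 * B * tail_const\<^sup>2 + 6)"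
  shows "AE \<omega> in M. \<forall>\<^sub>F m in sequentially.
    (\<forall>k\<ge>1. prop_ge k (rank1_graph Y m \<omega>) \<le> (1 / c) / real k) \<and>
    (\<forall>k\<ge>1. real k \<le> c * real (num_vertices (rank1_graph Y m \<omega>)) \<longrightarrow>
       c / real k \<le> prop_ge k (rank1_graph Y m \<omega>))"
  using AE_num_vertices_ge[OF a]
proof eventually_elim
  define U where "U = 8 * B * tail_const\<^sup>2 + 6"
  have U: "U > 0" using B by (simp add: U_def add_nonneg_pos)
  have c: "c = a / 4 / U" by (simp add: c_def U_def)
  have large: "\<forall>\<^sub>F m in sequentially. 1 \<le> a * N m" using a gamma by real_asymp
  fix \<omega> assume *: "\<forall>\<^sub>F m in sequentially. \<forall>k\<ge>1.
    real (num_vertices_ge k (rank1_graph Y m \<omega>)) * real k \<le> (8 * B * tail_const\<^sup>2 + 6) * N m \<and>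
    (real k \<le> a * N m \<longrightarrow>
      a / 4 * N m \<le> real (num_vertices_ge k (rank1_graph Y m \<omega>)) * real k)"
  show "\<forall>\<^sub>F m in sequentially.
    (\<forall>k\<ge>1. prop_ge k (rank1_graph Y m \<omega>) \<le> (1 / c) / real k) \<and>
    (\<forall>k\<ge>1. real k \<le> c * real (num_vertices (rank1_graph Y m \<omega>)) \<longrightarrow>
       c / real k \<le> prop_ge k (rank1_graph Y m \<omega>))"
    using * large
  proof eventually_elim
    case (elim m)
    define v where "v = real (num_vertices (rank1_graph Y m \<omega>))"
    define w where "w k = real (num_vertices_ge k (rank1_graph Y m \<omega>))" for k
    have N: "N m > 0" using elim(2) by (cases "m = 0") auto
    have upper: "w k * real k \<le> U * N m" if "k \<ge> 1" for k
      using elim(1) that by (simp add: w_def U_def)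
    have lower: "a / 4 * N m \<le> w k * real k" if "k \<ge> 1" "real k \<le> a * N m" for k
      using elim(1) that by (simp add: w_def)
    have v1: "v = w 1" by (simp add: v_def w_def num_vertices_eq)
    have v_upper: "v \<le> U * N m" using upper[of 1] v1 by simp
    have v_lower: "a / 4 * N m \<le> v" using lower[of 1] elim(2) v1 by simp
    then have v: "v > 0" using a N by (intro less_le_trans[OF _ v_lower]) auto
    have prop_eq: "prop_ge k (rank1_graph Y m \<omega>) = w k / v" for k
      by (simp add: prop_ge_def w_def v_def)
    show ?case unfolding prop_eq v_def[symmetric]
    proof (intro conjI allI impI)
      fix k :: nat assume k: "k \<ge> 1"
      have "w k \<le> U * N m / real k" using upper[OF k] k by (simp add: pos_le_divide_eq)
      then have "w k / v \<le> (U * N m / real k) / (a / 4 * N m)"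
        using v_lower a N U by (intro frac_le) auto
      also have "\<dots> = (1 / c) / real k" using N U a by (simp add: c mult.commute)
      finally show "w k / v \<le> (1 / c) / real k" .
    next
      fix k :: nat assume k: "k \<ge> 1" and kc: "real k \<le> c * v"
      have "c * v \<le> c * (U * N m)" using v_upper a U by (intro mult_left_mono) (auto simp: c)
      also have "\<dots> = a / 4 * N m" using U by (simp add: c)
      also have "\<dots> \<le> a * N m" using a N by simp
      finally have "real k \<le> a * N m" using kc by linarith
      then have "a / 4 * N m / real k \<le> w k" using lower[OF k] k by (simp add: field_simps)
      then have "(a / 4 * N m / real k) / (U * N m) \<le> w k / v"
        using v_upper v a N k by (intro frac_le) (auto simp: w_def)
      moreover have "(a / 4 * N m / real k) / (U * N m) = c / real k" using N U by (simp add: c)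
      ultimately show "c / real k \<le> w k / v" by simp
    qed
  qed
qed

lemma mu_norm_pos:
  assumes "pmf q 1 > 0" "pmf q 2 > 0"
  shows "mu_norm q > 0"
proof -
  define S where "S = {(i, j). (1::nat) \<le> i \<and> i < j}"
  have "pmf (pair_pmf q q) summable_on S"
    by (rule abs_summable_summable) (use pmf_abs_summable[of "pair_pmf q q" S] in \<open>simp only: abs_summable_equivalent\<close>)
  then have "(\<lambda>p. 2 * pmf (pair_pmf q q) p) summable_on S" by (rule summable_on_cmult_right)
  also have "?this \<longleftrightarrow> (\<lambda>(i, j). mu q i j) summable_on S"
    by (rule summable_on_cong) (auto simp: S_def mu_def pmf_pair)
  finally have sm: "(\<lambda>(i, j). mu q i j) summable_on S" .
  have "0 < (\<Sum>(i, j)\<in>{(1, 2)}. mu q i j)" using assms by (simp add: mu_def)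
  also have "\<dots> \<le> infsum (\<lambda>(i, j). mu q i j) S"
    by (rule finite_sum_le_infsum[OF sm]) (auto simp: S_def mu_def)
  finally show ?thesis by (simp add: mu_norm_def S_def)
qed

theorem theorem9p2:
  fixes \<gamma> :: real and q :: "nat pmf"
  assumes "\<gamma> > 1"
    and "set_pmf q \<subseteq> {1..}"
    and "asymp_seq (pmf q) (\<lambda>i. real i powr (- \<gamma>))"
  shows "\<exists>c>0. \<exists>C>0. \<forall>(M :: 'a measure) Y. rank1_edge_sequence q M Y \<longrightarrow>
    (AE \<omega> in M. \<forall>\<^sub>F m in sequentially.
       (\<forall>k\<ge>1. prop_ge k (rank1_graph Y m \<omega>) \<le> C / real k) \<and>
       (\<forall>k\<ge>1. real k \<le> c * real (num_vertices (rank1_graph Y m \<omega>)) \<longrightarrow>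
          prop_ge k (rank1_graph Y m \<omega>) \<ge> c / real k))"
proof -
  obtain c\<^sub>0 C\<^sub>0 where c0: "c\<^sub>0 > 0" and C0: "C\<^sub>0 > 0"
    and q: "\<And>i. i \<ge> 1 \<Longrightarrow> c\<^sub>0 * real i powr (- \<gamma>) \<le> pmf q i"
      "\<And>i. i \<ge> 1 \<Longrightarrow> pmf q i \<le> C\<^sub>0 * real i powr (- \<gamma>)"
    using assms(3) unfolding asymp_seq_def by blast
  have "pmf q i > 0" if "i \<ge> 1" for i
    using that c0 by (intro less_le_trans[OF _ q(1)]) auto
  then have norm: "mu_norm q > 0" by (intro mu_norm_pos) auto
  define b where "b = 2 * c\<^sub>0\<^sup>2 / mu_norm q"
  define B where "B = 2 * C\<^sub>0\<^sup>2 / mu_norm q"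
  \<comment> \<open>Small enough that an edge \<open>{i, j}\<close> with \<open>i * j \<le> 2 * a * N m\<close> has probability at least \<open>12 / m\<close>.\<close>
  define a where "a = min 1 ((b / 12) powr (1 / \<gamma>) / 2)"
  have b: "b > 0" and B: "B > 0" using c0 C0 norm by (simp_all add: b_def B_def)
  have a: "a > 0" "a \<le> 1" using b by (auto simp: a_def)
  have "((b / 12) powr (1 / \<gamma>)) powr (- \<gamma>) \<le> (2 * a) powr (- \<gamma>)"
    using a assms(1) by (intro powr_mono2') (auto simp: a_def)
  then have "12 / b \<le> (2 * a) powr (- \<gamma>)"
    using assms(1) b by (simp add: powr_powr powr_minus_divide)
  then have a12: "b * (2 * a) powr (- \<gamma>) \<ge> 12" using b by (simp add: field_simps)
  have edges: "power_law_edges M Y \<gamma> b B" if "rank1_edge_sequence q M Y" for M :: "'a measure" and Y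
  proof -
    have Y: "prob_space M" "prob_space.indep_vars M (\<lambda>_. count_space two_subsets) Y {1..}"
      and P: "\<And>k i j. k \<ge> 1 \<Longrightarrow> 1 \<le> i \<Longrightarrow> i < j \<Longrightarrow>
        measure M {\<omega> \<in> space M. Y k \<omega> = {i, j}} = mu q i j / mu_norm q"
      using that unfolding rank1_edge_sequence_def by blast+
    interpret prob_space M by (rule Y)
    show ?thesis
    proof unfold_locales
      show "indep_vars (\<lambda>_. count_space two_subsets) Y {1..}" by (rule Y)
      show "\<gamma> > 1" "B > 0" by fact+
      fix t i j :: nat assume t: "t \<ge> 1" and i: "i \<ge> 1" and ij: "i < j"
      have j: "j \<ge> 1" using ij by simp
      have p: "prob {\<omega> \<in> space M. Y t \<omega> = {i, j}} = 2 * (pmf q i * pmf q j) / mu_norm q"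
        using P[OF t i ij] ij by (simp add: mu_def)
      have "(c\<^sub>0 * real i powr (- \<gamma>)) * (c\<^sub>0 * real j powr (- \<gamma>)) \<le> pmf q i * pmf q j"
        using q(1)[OF i] q(1)[OF j] c0 by (intro mult_mono) auto
      then have "2 * ((c\<^sub>0 * real i powr (- \<gamma>)) * (c\<^sub>0 * real j powr (- \<gamma>))) / mu_norm q
        \<le> prob {\<omega> \<in> space M. Y t \<omega> = {i, j}}"
        unfolding p using norm by (intro divide_right_mono mult_left_mono) auto
      then show "b * (real i * real j) powr (- \<gamma>) \<le> prob {\<omega> \<in> space M. Y t \<omega> = {i, j}}"
        by (simp add: b_def powr_mult power2_eq_square mult_ac)
      have "pmf q i * pmf q j \<le> (C\<^sub>0 * real i powr (- \<gamma>)) * (C\<^sub>0 * real j powr (- \<gamma>))"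
        using q(2)[OF i] q(2)[OF j] C0 by (intro mult_mono) auto
      then have "prob {\<omega> \<in> space M. Y t \<omega> = {i, j}}
        \<le> 2 * ((C\<^sub>0 * real i powr (- \<gamma>)) * (C\<^sub>0 * real j powr (- \<gamma>))) / mu_norm q"
        unfolding p using norm by (intro divide_right_mono mult_left_mono) auto
      then show "prob {\<omega> \<in> space M. Y t \<omega> = {i, j}} \<le> B * (real i * real j) powr (- \<gamma>)"
        by (simp add: B_def powr_mult power2_eq_square mult_ac)
    qed
  qed
  define c where "c = a / 4 / (8 * B * (2 powr \<gamma> / (\<gamma> - 1))\<^sup>2 + 6)"
  have "c > 0" using a B by (simp add: c_def add_nonneg_pos)
  moreover have "1 / c > 0" using \<open>c > 0\<close> by simp
  moreover have "AE \<omega> in M. \<forall>\<^sub>F m in sequentially.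
       (\<forall>k\<ge>1. prop_ge k (rank1_graph Y m \<omega>) \<le> (1 / c) / real k) \<and>
       (\<forall>k\<ge>1. real k \<le> c * real (num_vertices (rank1_graph Y m \<omega>)) \<longrightarrow>
          prop_ge k (rank1_graph Y m \<omega>) \<ge> c / real k)"
    if "rank1_edge_sequence q M Y" for M :: "'a measure" and Y
  proof -
    interpret power_law_edges M Y \<gamma> b B by (rule edges[OF that])
    show ?thesis using AE_prop_ge[OF a a12] unfolding c_def tail_const_def .
  qed
  ultimately show ?thesis by blast
qed

end
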